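(* Let $(\gamma,\nu):I\to\Delta_1$ be a spacelike Legendre curve with curvature $(m,n)$ such that $\{t\in I:n(t)\ne0\}$ is dense in $I$, and let $(x_T^\pm,\nu_T^\pm):\mathbb R\times I\to\Delta_1$ be the one-parameter family of spacelike Legendre curves given by $$x_T^\pm(s,t)=\gamma(t)+s\mu(t)+\frac{s^2}{2}(\gamma(t)\pm\nu(t)),\qquad \nu_T^\pm(s,t)=\mp\nu(t)+s\mu(t)+\frac{s^2}{2}(\gamma(t)\pm\nu(t)).$$ Let $s_\pm:I\to\mathbb R$ be a solution of the Riccati equation $\dot s_\pm=\frac{m\pm n}{2}s_\pm^2-m$. Then the map $e_T^\pm[\pi/2]:I\to\mathbb R\times I$, $e_T^\pm[\pi/2](t)=(s_\pm(t),t)$, is a pre-$\pi/2$-enveloid of $x_T^\pm$, and the horocyclic involute of $\gamma$, $$Inv^\pm(\gamma,s_\pm)(t)=x_T^\pm\circ e_T^\pm[\pi/2](t)=E_T^\pm[\pi/2](t),$$ is a $\pi/2$-enveloid (normal envelope) of $x_T^\pm$.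
   Context: All maps are $C^\infty$; $I,J,U\subset\mathbb R$ are intervals; a dot denotes the derivative. In every formula with $\pm,\mp$ the upper signs are taken together and the lower signs together. $\mathbb R^3_1$ is $\mathbb R^3$ with $\langle x,y\rangle=-x_1y_1+x_2y_2+x_3y_3$ and $x\wedge y=(-(x_2y_3-x_3y_2),\,x_3y_1-x_1y_3,\,x_1y_2-x_2y_1)$. $H^2=\{x:\langle x,x\rangle=-1,\ x_1>0\}$, $S^2_1=\{x:\langle x,x\rangle=1\}$, $\Delta_1=\{(\nu_1,\nu_2)\in H^2\times S_1^2:\langle\nu_1,\nu_2\rangle=0\}$. A spacelike Legendre curve is a map $(\gamma,\nu):I\to\Delta_1$ with $\langle\dot\gamma,\nu\rangle=0$ on $I$; put $\mu=\gamma\wedge\nu$. Its curvature is the pair $(m,n)$ with $\dot\gamma=m\mu$, $\dot\nu=n\mu$ (then $\dot\mu=m\gamma-n\nu$). A one-parameter family of spacelike Legendre curves is a map $(x,\eta):J\times I\to\Delta_1$ with $\langle x_s,\eta\rangle(s,t)=0$ for all $(s,t)\in J\times I$; put $\mu_x=x\wedge\eta$. For $\alpha\in[0,\pi)$, a map $e[\alpha]:U\to J\times I$, $e[\alpha](u)=(s(u),t(u))$, is a pre-$\alpha$-enveloid of $x$, and $E[\alpha]=x\circ e[\alpha]$ is an $\alpha$-enveloid of $x$, if (1) $t:U\to I$ is surjective and non-constant on every non-trivial subinterval of $U$; (2) $\dot E[\alpha](u)$ and $(\cos\alpha)\,\mu_x(e[\alpha](u))+(\sin\alpha)\,\eta(e[\alpha](u))$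 are parallel (linearly dependent) for all $u\in U$. Horocyclic involute: $Inv^\pm(\gamma,s_\pm)=\gamma+s_\pm\mu+\frac{s_\pm^2}{2}(\gamma\pm\nu)$ for $s_\pm$ as in the claim. $E_T^\pm[\pi/2]$ denotes $x_T^\pm\circ e_T^\pm[\pi/2]$. *)

theory Defs
  imports "HOL-Analysis.Analysis"
begin

definition nontrivial_interval :: "real set \<Rightarrow> bool" where
  "nontrivial_interval I \<longleftrightarrow> is_interval I \<and> (\<exists>a\<in>I. \<exists>b\<in>I. a < b)"

(* Derivatives are taken within S, so they are one-sided at the end points that an interval
   contains. On non-trivial intervals and products of two of them the derivative is unique, and
   the existentially quantified f' is then the Frechet derivative of f at every point of S. *)
primrec Ck_on :: "nat \<Rightarrow> 'a::real_normed_vector set \<Rightarrow> ('a \<Rightarrow> 'b::real_normed_vector) \<Rightarrow> bool" where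
  "Ck_on 0 S f \<longleftrightarrow> continuous_on S f"
| "Ck_on (Suc k) S f \<longleftrightarrow>
     (\<exists>f'. (\<forall>p\<in>S. (f has_derivative f' p) (at p within S)) \<and> (\<forall>v. Ck_on k S (\<lambda>p. f' p v)))"

definition smooth_on :: "'a::real_normed_vector set \<Rightarrow> ('a \<Rightarrow> 'b::real_normed_vector) \<Rightarrow> bool" where
  "smooth_on S f \<longleftrightarrow> (\<forall>k. Ck_on k S f)"

definition linner :: "real^3 \<Rightarrow> real^3 \<Rightarrow> real" where
  "linner x y = - (x$1 * y$1) + x$2 * y$2 + x$3 * y$3"

definition lwedge :: "real^3 \<Rightarrow> real^3 \<Rightarrow> real^3" where
  "lwedge x y = vector [- (x$2 * y$3 - x$3 * y$2), x$3 * y$1 - x$1 * y$3, x$1 * y$2 - x$2 * y$1]"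

definition hyperbolic_plane :: "(real^3) set" where
  "hyperbolic_plane = {x. linner x x = -1 \<and> x$1 > 0}"

definition de_sitter :: "(real^3) set" where
  "de_sitter = {x. linner x x = 1}"

definition Delta1 :: "((real^3) \<times> (real^3)) set" where
  "Delta1 = {(v, w). v \<in> hyperbolic_plane \<and> w \<in> de_sitter \<and> linner v w = 0}"

definition parallel :: "'a::real_vector \<Rightarrow> 'a \<Rightarrow> bool" where
  "parallel v w \<longleftrightarrow> (\<exists>a b::real. (a, b) \<noteq> (0, 0) \<and> a *\<^sub>R v + b *\<^sub>R w = 0)"

definition spacelike_legendre_curve ::
    "real set \<Rightarrow> (real \<Rightarrow> real^3) \<Rightarrow> (real \<Rightarrow> real^3) \<Rightarrow> bool" where
  "spacelike_legendre_curve I \<gamma> \<nu> \<longleftrightarrow>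
     nontrivial_interval I \<and> smooth_on I \<gamma> \<and> smooth_on I \<nu> \<and>
     (\<forall>t\<in>I. (\<gamma> t, \<nu> t) \<in> Delta1) \<and>
     (\<forall>t\<in>I. linner (vector_derivative \<gamma> (at t within I)) (\<nu> t) = 0)"

definition legendre_curvature ::
    "real set \<Rightarrow> (real \<Rightarrow> real^3) \<Rightarrow> (real \<Rightarrow> real^3) \<Rightarrow> (real \<Rightarrow> real) \<Rightarrow> (real \<Rightarrow> real) \<Rightarrow> bool" where
  "legendre_curvature I \<gamma> \<nu> m n \<longleftrightarrow>
     (\<forall>t\<in>I. (\<gamma> has_vector_derivative m t *\<^sub>R lwedge (\<gamma> t) (\<nu> t)) (at t within I) \<and>
            (\<nu> has_vector_derivative n t *\<^sub>R lwedge (\<gamma> t) (\<nu> t)) (at t within I))"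

definition legendre_family ::
    "real set \<Rightarrow> real set \<Rightarrow> (real \<times> real \<Rightarrow> real^3) \<Rightarrow> (real \<times> real \<Rightarrow> real^3) \<Rightarrow> bool" where
  "legendre_family J I x \<eta> \<longleftrightarrow>
     nontrivial_interval J \<and> nontrivial_interval I \<and>
     smooth_on (J \<times> I) x \<and> smooth_on (J \<times> I) \<eta> \<and>
     (\<forall>p\<in>J \<times> I. (x p, \<eta> p) \<in> Delta1) \<and>
     (\<forall>s\<in>J. \<forall>t\<in>I. linner (vector_derivative (\<lambda>\<sigma>. x (\<sigma>, t)) (at s within J)) (\<eta> (s, t)) = 0)"

definition pre_enveloid ::
    "real \<Rightarrow> real set \<Rightarrow> real set \<Rightarrow> (real \<times> real \<Rightarrow> real^3) \<Rightarrow> (real \<times> real \<Rightarrow> real^3) \<Rightarrow>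
     real set \<Rightarrow> (real \<Rightarrow> real \<times> real) \<Rightarrow> bool" where
  "pre_enveloid \<alpha> J I x \<eta> U e \<longleftrightarrow>
     0 \<le> \<alpha> \<and> \<alpha> < pi \<and> legendre_family J I x \<eta> \<and>
     nontrivial_interval U \<and> smooth_on U e \<and> e ` U \<subseteq> J \<times> I \<and>
     (snd \<circ> e) ` U = I \<and>
     (\<forall>K. K \<subseteq> U \<and> nontrivial_interval K \<longrightarrow> \<not> (snd \<circ> e) constant_on K) \<and>
     (\<forall>u\<in>U. parallel (vector_derivative (x \<circ> e) (at u within U))
              (cos \<alpha> *\<^sub>R lwedge (x (e u)) (\<eta> (e u)) + sin \<alpha> *\<^sub>R \<eta> (e u)))"

definition enveloid ::
    "real \<Rightarrow> real set \<Rightarrow> real set \<Rightarrow> (real \<times> real \<Rightarrow> real^3) \<Rightarrow> (real \<times> real \<Rightarrow> real^3) \<Rightarrow>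
     real set \<Rightarrow> (real \<Rightarrow> real^3) \<Rightarrow> bool" where
  "enveloid \<alpha> J I x \<eta> U E \<longleftrightarrow>
     (\<exists>e. pre_enveloid \<alpha> J I x \<eta> U e \<and> (\<forall>u\<in>U. E u = (x \<circ> e) u))"

(* In the next three definitions \<epsilon> = 1 gives the upper signs and \<epsilon> = -1 the lower ones. *)

definition x_T :: "real \<Rightarrow> (real \<Rightarrow> real^3) \<Rightarrow> (real \<Rightarrow> real^3) \<Rightarrow> real \<times> real \<Rightarrow> real^3" where
  "x_T \<epsilon> \<gamma> \<nu> = (\<lambda>(s, t).
     \<gamma> t + s *\<^sub>R lwedge (\<gamma> t) (\<nu> t) + (s^2 / 2) *\<^sub>R (\<gamma> t + \<epsilon> *\<^sub>R \<nu> t))"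

definition nu_T :: "real \<Rightarrow> (real \<Rightarrow> real^3) \<Rightarrow> (real \<Rightarrow> real^3) \<Rightarrow> real \<times> real \<Rightarrow> real^3" where
  "nu_T \<epsilon> \<gamma> \<nu> = (\<lambda>(s, t).
     - (\<epsilon> *\<^sub>R \<nu> t) + s *\<^sub>R lwedge (\<gamma> t) (\<nu> t) + (s^2 / 2) *\<^sub>R (\<gamma> t + \<epsilon> *\<^sub>R \<nu> t))"

definition horocyclic_involute ::
    "real \<Rightarrow> (real \<Rightarrow> real^3) \<Rightarrow> (real \<Rightarrow> real^3) \<Rightarrow> (real \<Rightarrow> real) \<Rightarrow> real \<Rightarrow> real^3" where
  "horocyclic_involute \<epsilon> \<gamma> \<nu> s t =
     \<gamma> t + s t *\<^sub>R lwedge (\<gamma> t) (\<nu> t) + ((s t)^2 / 2) *\<^sub>R (\<gamma> t + \<epsilon> *\<^sub>R \<nu> t)"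

end

theory Submission
  imports Defs
begin

text \<open>The vectors \<open>\<gamma>, \<nu>, \<mu>\<close> form a Lorentz-orthonormal frame, so the claims about
  \<open>x\<^sub>T\<close> and \<open>\<nu>\<^sub>T\<close> reduce to algebra in this frame. The Riccati equation is exactly the condition
  under which the derivative of \<open>x\<^sub>T (s t, t)\<close> equals \<open>(m + \<epsilon> n) s \<nu>\<^sub>T\<close>.\<close>

section \<open>Smooth maps\<close>

text \<open>For the product rule: its terms contain the undifferentiated factors, which must be
  known to be of the lower order as well.\<close>

lemma Ck_on_Suc_imp: "Ck_on (Suc k) S f \<Longrightarrow> Ck_on k S f"
proof (induction k arbitrary: f)
  case 0
  then show ?case
    by (auto dest: has_derivative_continuous simp: continuous_on_eq_continuous_within)
next
  case (Suc k)
  obtain f' where "\<forall>p\<in>S. (f has_derivative f' p) (at p within S)"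
    and "\<And>v. Ck_on (Suc k) S (\<lambda>p. f' p v)"
    using Suc.prems unfolding Ck_on.simps(2)[of "Suc k"] by blast
  then show ?case
    using Suc.IH by auto
qed

lemma Ck_on_const: "Ck_on k S (\<lambda>_. c)"
proof (induction k arbitrary: c)
  case (Suc k)
  then show ?case
    by (auto intro!: exI[of _ "\<lambda>_ _. 0"])
qed simp

lemma Ck_on_bounded_linear_comp:
  assumes L: "bounded_linear L" and f: "Ck_on k S f"
  shows "Ck_on k S (\<lambda>p. L (f p))"
  using f
proof (induction k arbitrary: f)
  case 0
  then show ?case
    using bounded_linear.continuous_on[OF L] by auto
next
  case (Suc k)
  then obtain f' where "\<forall>p\<in>S. (f has_derivative f' p) (at p within S)"
    and "\<And>v. Ck_on k S (\<lambda>p. f' p v)"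
    by auto
  then show ?case
    using Suc.IH
    by (auto intro!: exI[of _ "\<lambda>p v. L (f' p v)"] bounded_linear.has_derivative[OF L])
qed

text \<open>A linear inner map is its own derivative, so the derivative of the composite in
  direction \<open>v\<close> is \<open>f'\<close> in the fixed direction \<open>L v\<close>, again
  composed with \<open>L\<close>; the induction closes. It is applied to \<open>snd\<close>, which
  turns maps of t into maps of (s, t).\<close>

lemma Ck_on_comp_bounded_linear:
  assumes L: "bounded_linear L" and sub: "L ` S \<subseteq> T" and f: "Ck_on k T f"
  shows "Ck_on k S (\<lambda>p. f (L p))"
  using f
proof (induction k arbitrary: f)
  case 0
  then show ?case
    using continuous_on_compose2[OF _ linear_continuous_on[OF L] sub] by auto
next
  case (Suc k)
  then obtain f' where f': "\<forall>p\<in>T. (f has_derivative f' p) (at p within T)"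
    and "\<And>v. Ck_on k T (\<lambda>p. f' p v)"
    by auto
  moreover have "((\<lambda>q. f (L q)) has_derivative (\<lambda>v. f' (L p) (L v))) (at p within S)"
    if "p \<in> S" for p
    using has_derivative_in_compose[OF bounded_linear_imp_has_derivative[OF L], of f "f' (L p)" p S]
      has_derivative_subset[OF _ sub] f' sub that by blast
  ultimately show ?case
    using Suc.IH by (auto intro!: exI[of _ "\<lambda>p v. f' (L p) (L v)"])
qed

lemma Ck_on_add:
  assumes "Ck_on k S f" and "Ck_on k S g"
  shows "Ck_on k S (\<lambda>p. f p + g p)"
  using assms
proof (induction k arbitrary: f g)
  case 0
  then show ?case
    by (auto intro: continuous_intros)
next
  case (Suc k)
  then obtain f' g' where "\<forall>p\<in>S. (f has_derivative f' p) (at p within S)"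
    "\<And>v. Ck_on k S (\<lambda>p. f' p v)"
    "\<forall>p\<in>S. (g has_derivative g' p) (at p within S)" "\<And>v. Ck_on k S (\<lambda>p. g' p v)"
    by auto
  then show ?case
    using Suc.IH by (auto intro!: exI[of _ "\<lambda>p v. f' p v + g' p v"] has_derivative_add)
qed

text \<open>One Leibniz induction covers both products that occur, scalar multiplication and
  \<open>lwedge\<close>.\<close>

lemma Ck_on_bounded_bilinear:
  assumes B: "bounded_bilinear B" and "Ck_on k S f" and "Ck_on k S g"
  shows "Ck_on k S (\<lambda>p. B (f p) (g p))"
  using assms(2,3)
proof (induction k arbitrary: f g)
  case 0
  then show ?case
    using bounded_bilinear.continuous_on[OF B] by auto
next
  case (Suc k)
  then obtain f' g' where "\<forall>p\<in>S. (f has_derivative f' p) (at p within S)"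
    "\<And>v. Ck_on k S (\<lambda>p. f' p v)"
    "\<forall>p\<in>S. (g has_derivative g' p) (at p within S)" "\<And>v. Ck_on k S (\<lambda>p. g' p v)"
    by auto
  moreover have "Ck_on k S f" "Ck_on k S g"
    using Suc.prems by (blast intro: Ck_on_Suc_imp)+
  ultimately show ?case
    using Suc.IH
    by (auto intro!: exI[of _ "\<lambda>p v. B (f p) (g' p v) + B (f' p v) (g p)"] Ck_on_add
        bounded_bilinear.FDERIV[OF B])
qed

lemma Ck_on_id: "Ck_on k S (\<lambda>p. p)"
  by (cases k) (auto intro!: exI[of _ "\<lambda>_ v. v"] Ck_on_const)

lemma smooth_on_const: "smooth_on S (\<lambda>_. c)"
  by (simp add: smooth_on_def Ck_on_const)

lemma smooth_on_bounded_linear: "bounded_linear L \<Longrightarrow> smooth_on S L"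
  using Ck_on_bounded_linear_comp[OF _ Ck_on_id] by (auto simp: smooth_on_def)

lemma smooth_on_bounded_linear_comp:
  "bounded_linear L \<Longrightarrow> smooth_on S f \<Longrightarrow> smooth_on S (\<lambda>p. L (f p))"
  by (simp add: smooth_on_def Ck_on_bounded_linear_comp)

lemma smooth_on_comp_bounded_linear:
  "bounded_linear L \<Longrightarrow> L ` S \<subseteq> T \<Longrightarrow> smooth_on T f \<Longrightarrow> smooth_on S (\<lambda>p. f (L p))"
  using Ck_on_comp_bounded_linear unfolding smooth_on_def by blast

lemma smooth_on_add: "smooth_on S f \<Longrightarrow> smooth_on S g \<Longrightarrow> smooth_on S (\<lambda>p. f p + g p)"
  by (simp add: smooth_on_def Ck_on_add)

lemma smooth_on_bounded_bilinear:
  "bounded_bilinear B \<Longrightarrow> smooth_on S f \<Longrightarrow> smooth_on S g \<Longrightarrow> smooth_on S (\<lambda>p. B (f p) (g p))"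
  by (simp add: smooth_on_def Ck_on_bounded_bilinear)

lemmas smooth_on_scaleR = smooth_on_bounded_bilinear[OF bounded_bilinear_scaleR]

lemma smooth_on_Pair:
  assumes "smooth_on S f" and "smooth_on S g"
  shows "smooth_on S (\<lambda>p. (f p, g p))"
proof -
  \<comment> \<open>A pair is a sum of two linear embeddings, so no further induction is
    needed.\<close>
  have "smooth_on S (\<lambda>p. (f p, 0) + (0, g p))"
    using assms
    by (intro smooth_on_add smooth_on_bounded_linear_comp[of "\<lambda>x. (x, 0)"]
        smooth_on_bounded_linear_comp[of "\<lambda>x. (0, x)"] bounded_linear_Pair
        bounded_linear_zero bounded_linear_ident)
  then show ?thesis
    by simp
qed

section \<open>The Lorentz product and the Lorentz cross product\<close>

lemma linner_commute: "linner x y = linner y x"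
  by (simp add: linner_def mult.commute)

lemma linner_simps [simp]:
  "linner (x + y) z = linner x z + linner y z"
  "linner z (x + y) = linner z x + linner z y"
  "linner (a *\<^sub>R x) z = a * linner x z"
  "linner z (a *\<^sub>R x) = a * linner z x"
  "linner (x - y) z = linner x z - linner y z"
  "linner z (x - y) = linner z x - linner z y"
  "linner (- x) z = - linner x z"
  "linner z (- x) = - linner z x"
  by (simp_all add: linner_def algebra_simps)

lemma lwedge_nth:
  "lwedge x y $ 1 = - (x$2 * y$3 - x$3 * y$2)"
  "lwedge x y $ 2 = x$3 * y$1 - x$1 * y$3"
  "lwedge x y $ 3 = x$1 * y$2 - x$2 * y$1"
  by (simp_all add: lwedge_def)

text \<open>Boundedness is automatic in finite dimension. This supplies both the smoothness of \<mu>
  and the product rule for it.\<close>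

lemma bounded_bilinear_lwedge: "bounded_bilinear lwedge"
  by (intro bilinear_conv_bounded_bilinear[THEN iffD1])
    (auto simp: bilinear_def vec_eq_iff forall_3 lwedge_nth algebra_simps intro!: linearI)

lemma lwedge_antisym: "lwedge x y = - lwedge y x"
  by (simp add: vec_eq_iff forall_3 lwedge_nth)

lemma lwedge_lwedge: "lwedge (lwedge x y) z = linner y z *\<^sub>R x - linner x z *\<^sub>R y"
  by (simp add: vec_eq_iff forall_3 lwedge_nth linner_def algebra_simps)

text \<open>The Lorentzian Lagrange identity; its sign is opposite to the Euclidean one, which makes
  \<mu> a spacelike unit vector.\<close>

lemma linner_lwedge_lwedge:
  "linner (lwedge x y) (lwedge z w) = linner x w * linner y z - linner x z * linner y w"
  by (simp add: lwedge_nth linner_def algebra_simps)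

lemma linner_lwedge_same [simp]:
  "linner (lwedge x y) x = 0" "linner (lwedge x y) y = 0"
  "linner x (lwedge x y) = 0" "linner y (lwedge x y) = 0"
  by (simp_all add: lwedge_nth linner_def algebra_simps)

lemma Delta1_linner:
  assumes "(x, y) \<in> Delta1"
  shows "linner x x = -1" "linner y y = 1" "linner x y = 0" "linner y x = 0" "x$1 > 0"
    "linner (lwedge x y) (lwedge x y) = 1"
  using assms
  by (auto simp: Delta1_def hyperbolic_plane_def de_sitter_def linner_lwedge_lwedge
      linner_commute[of y x])

lemma Delta1_lwedge_lwedge:
  assumes "(x, y) \<in> Delta1"
  shows "lwedge (lwedge x y) y = x" and "lwedge x (lwedge x y) = - y"
  using lwedge_antisym[of x "lwedge x y"] by (simp_all add: lwedge_lwedge Delta1_linner[OF assms])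

text \<open>This is the expansion of <e, e> = -1 for e = (1, 0, 0) in the orthonormal frame
  \<open>x\<close>, \<open>y\<close>, \<open>lwedge x y\<close>.\<close>

lemma Delta1_lwedge_nth_1_sq:
  assumes "(x, y) \<in> Delta1"
  shows "(lwedge x y $ 1)\<^sup>2 = (x$1)\<^sup>2 - (y$1)\<^sup>2 - 1"
proof -
  have eqs: "(x$2)\<^sup>2 + (x$3)\<^sup>2 = (x$1)\<^sup>2 - 1" "(y$2)\<^sup>2 + (y$3)\<^sup>2 = (y$1)\<^sup>2 + 1"
    "x$2 * y$2 + x$3 * y$3 = x$1 * y$1"
    using Delta1_linner[OF assms] by (simp_all add: linner_def power2_eq_square)
  \<comment> \<open>Up to sign the first coordinate is a 2 x 2 determinant, so the planar Lagrange
    identity applies.\<close>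
  have "(lwedge x y $ 1)\<^sup>2 =
      ((x$2)\<^sup>2 + (x$3)\<^sup>2) * ((y$2)\<^sup>2 + (y$3)\<^sup>2) - (x$2 * y$2 + x$3 * y$3)\<^sup>2"
    by (simp add: lwedge_nth power2_eq_square algebra_simps)
  also have "\<dots> = (x$1)\<^sup>2 - (y$1)\<^sup>2 - 1"
    unfolding eqs by (simp add: power2_eq_square algebra_simps)
  finally show ?thesis .
qed

text \<open>The equation <h, h> = -1 allows both sheets of the hyperboloid; a sum of squares selects
  the sheet of \<open>hyperbolic_plane\<close>.\<close>

lemma horocycle_nth_1_pos:
  assumes xy: "(x, y) \<in> Delta1" and eps: "\<epsilon>\<^sup>2 = (1::real)"
  shows "(x + s *\<^sub>R lwedge x y + (s\<^sup>2 / 2) *\<^sub>R (x + \<epsilon> *\<^sub>R y)) $ 1 > 0" (is "?h $ 1 > 0")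
proof -
  define a b c where "a = x$1" and "b = y$1" and "c = lwedge x y $ 1"
  have c: "c\<^sup>2 = a\<^sup>2 - b\<^sup>2 - 1"
    using Delta1_lwedge_nth_1_sq[OF xy] by (simp add: a_def b_def c_def)
  have "a > 0"
    using Delta1_linner(5)[OF xy] by (simp add: a_def)
  \<comment> \<open>Multiplying by 4a > 0 allows completing the square in \<open>s * c\<close>; the
    frame identity for \<open>c\<close> then makes the remainder positive whenever s is
    nonzero.\<close>
  have "4 * a * (?h $ 1) = (2 * a + s * c)\<^sup>2 + s\<^sup>2 * (2 * a * (a + \<epsilon> * b) - c\<^sup>2)"
    by (simp add: a_def b_def c_def power2_eq_square algebra_simps)
  also have "2 * a * (a + \<epsilon> * b) - c\<^sup>2 = (a + \<epsilon> * b)\<^sup>2 + 1"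
    using eps unfolding c by (simp add: power2_sum power_mult_distrib algebra_simps power2_eq_square)
  finally have eq: "4 * a * (?h $ 1) = (2 * a + s * c)\<^sup>2 + s\<^sup>2 * ((a + \<epsilon> * b)\<^sup>2 + 1)" .
  have "(2 * a + s * c)\<^sup>2 + s\<^sup>2 * ((a + \<epsilon> * b)\<^sup>2 + 1) > 0"
  proof (cases "s = 0")
    case False
    then show ?thesis
      by (intro add_nonneg_pos mult_pos_pos) (auto intro: add_nonneg_pos)
  qed (use \<open>a > 0\<close> in simp)
  with eq have "4 * a * (?h $ 1) > 0"
    by linarith
  then show ?thesis
    using \<open>a > 0\<close> by (metis zero_less_mult_pos mult_pos_pos zero_less_numeral)
qed

section \<open>The family of tangent horocycles\<close>

text \<open>Put l = \<gamma> + \<epsilon>\<nu>. It is lightlike, orthogonal to \<mu>, and <\<gamma>,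
  l> = -1, so the two terms in s^2 of <\<open>x_T\<close>, \<open>x_T\<close>> cancel. Moreover
  \<open>nu_T\<close> = \<open>x_T\<close> - l and <\<open>x_T\<close>, l> = -1, which settles the
  other two products.\<close>

lemma horocycle_in_Delta1:
  assumes xy: "(\<gamma> t, \<nu> t) \<in> Delta1" and eps: "\<epsilon>\<^sup>2 = 1"
  shows "(x_T \<epsilon> \<gamma> \<nu> (s, t), nu_T \<epsilon> \<gamma> \<nu> (s, t)) \<in> Delta1"
proof -
  \<comment> \<open>These rules treat both signs at once; the second catches the square inside
    right-nested products.\<close>
  have e: "\<epsilon> * \<epsilon> = 1" "\<epsilon> * (\<epsilon> * r) = r" for r
    using eps by (simp_all add: power2_eq_square flip: mult.assoc)
  show ?thesis
    using horocycle_nth_1_pos[OF xy eps, of s]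
    by (simp add: Delta1_def hyperbolic_plane_def de_sitter_def x_T_def nu_T_def
        Delta1_linner[OF xy] e field_simps power2_eq_square)
qed

text \<open>With l = \<gamma> + \<epsilon>\<nu> the velocity is \<mu> + s l, and its product with
  \<open>nu_T\<close> is s<\<mu>, \<mu>> - s\<epsilon><l, \<nu>> = s - s.\<close>

lemma x_T_nu_T_orthogonal:
  assumes xy: "(\<gamma> t, \<nu> t) \<in> Delta1" and eps: "\<epsilon>\<^sup>2 = 1"
  shows "linner (vector_derivative (\<lambda>\<sigma>. x_T \<epsilon> \<gamma> \<nu> (\<sigma>, t)) (at s)) (nu_T \<epsilon> \<gamma> \<nu> (s, t)) = 0"
proof -
  have e: "\<epsilon> * \<epsilon> = 1" "\<epsilon> * (\<epsilon> * r) = r" for r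
    using eps by (simp_all add: power2_eq_square flip: mult.assoc)
  have "((\<lambda>\<sigma>. x_T \<epsilon> \<gamma> \<nu> (\<sigma>, t)) has_vector_derivative
      lwedge (\<gamma> t) (\<nu> t) + s *\<^sub>R (\<gamma> t + \<epsilon> *\<^sub>R \<nu> t)) (at s)"
    unfolding x_T_def by (auto intro!: derivative_eq_intros)
  then show ?thesis
    by (simp add: vector_derivative_at nu_T_def Delta1_linner[OF xy] e algebra_simps)
qed

lemma smooth_on_horocycles:
  assumes \<gamma>: "smooth_on I \<gamma>" and \<nu>: "smooth_on I \<nu>"
  shows "smooth_on (J \<times> I) (x_T \<epsilon> \<gamma> \<nu>)" and "smooth_on (J \<times> I) (nu_T \<epsilon> \<gamma> \<nu>)"
proof -
  note comp_snd = smooth_on_comp_bounded_linear[OF bounded_linear_snd, of "J \<times> I" I]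
  have g: "smooth_on (J \<times> I) (\<lambda>p. \<gamma> (snd p))" and v: "smooth_on (J \<times> I) (\<lambda>p. \<nu> (snd p))"
    using \<gamma> \<nu> by (auto intro!: comp_snd)
  have f: "smooth_on (J \<times> I) (fst :: real \<times> real \<Rightarrow> real)"
    by (rule smooth_on_bounded_linear[OF bounded_linear_fst])
  \<comment> \<open>The factor s^2/2 is written as a product of two linear functions of s, so that
    the bilinear rule applies.\<close>
  have f2: "smooth_on (J \<times> I) (\<lambda>p. ((1/2) * fst p) *\<^sub>R fst p)"
    by (intro smooth_on_scaleR f smooth_on_bounded_linear_comp[OF bounded_linear_mult_right])
  note rules = smooth_on_add smooth_on_scaleR f2 f g v smooth_on_const
    smooth_on_bounded_bilinear[OF bounded_bilinear_lwedge]
  have "smooth_on (J \<times> I) (\<lambda>p. \<gamma> (snd p) + fst p *\<^sub>R lwedge (\<gamma> (snd p)) (\<nu> (snd p)) +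
      (((1/2) * fst p) *\<^sub>R fst p) *\<^sub>R (\<gamma> (snd p) + \<epsilon> *\<^sub>R \<nu> (snd p)))"
    by (intro rules)
  then show "smooth_on (J \<times> I) (x_T \<epsilon> \<gamma> \<nu>)"
    by (simp add: x_T_def case_prod_beta' power2_eq_square)
  have "smooth_on (J \<times> I) (\<lambda>p. (- \<epsilon>) *\<^sub>R \<nu> (snd p) + fst p *\<^sub>R lwedge (\<gamma> (snd p)) (\<nu> (snd p)) +
      (((1/2) * fst p) *\<^sub>R fst p) *\<^sub>R (\<gamma> (snd p) + \<epsilon> *\<^sub>R \<nu> (snd p)))"
    by (intro rules)
  then show "smooth_on (J \<times> I) (nu_T \<epsilon> \<gamma> \<nu>)"
    by (simp add: nu_T_def case_prod_beta' power2_eq_square)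
qed

lemma legendre_family_horocycles:
  assumes curve: "spacelike_legendre_curve I \<gamma> \<nu>" and eps: "\<epsilon>\<^sup>2 = 1"
  shows "legendre_family UNIV I (x_T \<epsilon> \<gamma> \<nu>) (nu_T \<epsilon> \<gamma> \<nu>)"
proof -
  have "nontrivial_interval (UNIV :: real set)"
    by (auto simp: nontrivial_interval_def intro: gt_ex)
  then show ?thesis
    using curve smooth_on_horocycles horocycle_in_Delta1[OF _ eps] x_T_nu_T_orthogonal[OF _ eps]
    by (auto simp: legendre_family_def spacelike_legendre_curve_def)
qed

section \<open>Derivatives of the frame and of the horocyclic involute\<close>

lemma has_vector_derivative_lwedge_frame:
  assumes curv: "legendre_curvature I \<gamma> \<nu> m n" and xy: "(\<gamma> t, \<nu> t) \<in> Delta1" and t: "t \<in> I"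
  shows "((\<lambda>t. lwedge (\<gamma> t) (\<nu> t)) has_vector_derivative m t *\<^sub>R \<gamma> t - n t *\<^sub>R \<nu> t) (at t within I)"
  using bounded_bilinear.has_vector_derivative[OF bounded_bilinear_lwedge,
      of \<gamma> "m t *\<^sub>R lwedge (\<gamma> t) (\<nu> t)" t I \<nu> "n t *\<^sub>R lwedge (\<gamma> t) (\<nu> t)"] curv t
  by (simp add: legendre_curvature_def Delta1_lwedge_lwedge[OF xy]
      bounded_bilinear.scaleR_left[OF bounded_bilinear_lwedge]
      bounded_bilinear.scaleR_right[OF bounded_bilinear_lwedge])

lemma has_vector_derivative_horocyclic_involute:
  assumes curv: "legendre_curvature I \<gamma> \<nu> m n" and xy: "(\<gamma> t, \<nu> t) \<in> Delta1" and t: "t \<in> I"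
    and eps: "\<epsilon>\<^sup>2 = 1"
    and s: "(s has_real_derivative (m t + \<epsilon> * n t) / 2 * (s t)\<^sup>2 - m t) (at t within I)"
  shows "(horocyclic_involute \<epsilon> \<gamma> \<nu> s has_vector_derivative
    ((m t + \<epsilon> * n t) * s t) *\<^sub>R nu_T \<epsilon> \<gamma> \<nu> (s t, t)) (at t within I)"
proof -
  define \<mu> where "\<mu> = (\<lambda>t. lwedge (\<gamma> t) (\<nu> t))"
  define d where "d = (m t + \<epsilon> * n t) / 2 * (s t)\<^sup>2 - m t"
  have e: "\<epsilon> * \<epsilon> = 1" "\<epsilon> * (\<epsilon> * r) = r" for r
    using eps by (simp_all add: power2_eq_square flip: mult.assoc)
  have \<gamma>: "(\<gamma> has_vector_derivative m t *\<^sub>R \<mu> t) (at t within I)"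
    and \<nu>: "(\<nu> has_vector_derivative n t *\<^sub>R \<mu> t) (at t within I)"
    using curv t by (auto simp: legendre_curvature_def \<mu>_def)
  have \<mu>: "(\<mu> has_vector_derivative m t *\<^sub>R \<gamma> t - n t *\<^sub>R \<nu> t) (at t within I)"
    using has_vector_derivative_lwedge_frame[OF curv xy t] by (simp add: \<mu>_def)
  have s': "(s has_real_derivative d) (at t within I)"
    using s by (simp add: d_def)
  then have s2: "((\<lambda>t. (s t)\<^sup>2 / 2) has_real_derivative s t * d) (at t within I)"
    by (auto intro!: derivative_eq_intros)
  have "((\<lambda>t. \<gamma> t + s t *\<^sub>R \<mu> t + ((s t)\<^sup>2 / 2) *\<^sub>R (\<gamma> t + \<epsilon> *\<^sub>R \<nu> t)) has_vector_derivative
     m t *\<^sub>R \<mu> t + (s t *\<^sub>R (m t *\<^sub>R \<gamma> t - n t *\<^sub>R \<nu> t) + d *\<^sub>R \<mu> t) +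
     (((s t)\<^sup>2 / 2) *\<^sub>R (m t *\<^sub>R \<mu> t + \<epsilon> *\<^sub>R n t *\<^sub>R \<mu> t) + (s t * d) *\<^sub>R (\<gamma> t + \<epsilon> *\<^sub>R \<nu> t)))
     (at t within I)"
    by (intro has_vector_derivative_add has_vector_derivative_scaleR \<gamma> \<mu> s' s2
        bounded_linear.has_vector_derivative[OF bounded_linear_scaleR_right] \<nu>)
  \<comment> \<open>Let k = m + \<epsilon>n and l = \<gamma> + \<epsilon>\<nu>. Inserting d = k
    s^2/2 - m turns the coefficient of \<mu> into k s^2 and that of l into k s^3/2 - m s. What
    remains, s(m\<gamma> - n\<nu>) - m s l, is -\<epsilon> k s \<nu> because \<epsilon>^2 =
    1.\<close>
  moreover have "m t *\<^sub>R \<mu> t + (s t *\<^sub>R (m t *\<^sub>R \<gamma> t - n t *\<^sub>R \<nu> t) + d *\<^sub>R \<mu> t) +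
     (((s t)\<^sup>2 / 2) *\<^sub>R (m t *\<^sub>R \<mu> t + \<epsilon> *\<^sub>R n t *\<^sub>R \<mu> t) + (s t * d) *\<^sub>R (\<gamma> t + \<epsilon> *\<^sub>R \<nu> t))
     = ((m t + \<epsilon> * n t) * s t) *\<^sub>R nu_T \<epsilon> \<gamma> \<nu> (s t, t)"
    by (simp add: nu_T_def \<mu>_def d_def vec_eq_iff power2_eq_square field_simps e)
  moreover have "horocyclic_involute \<epsilon> \<gamma> \<nu> s =
      (\<lambda>t. \<gamma> t + s t *\<^sub>R \<mu> t + ((s t)\<^sup>2 / 2) *\<^sub>R (\<gamma> t + \<epsilon> *\<^sub>R \<nu> t))"
    by (simp add: horocyclic_involute_def \<mu>_def fun_eq_iff)
  ultimately show ?thesis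
    by simp
qed

lemma x_T_comp_graph: "x_T \<epsilon> \<gamma> \<nu> \<circ> (\<lambda>t. (s t, t)) = horocyclic_involute \<epsilon> \<gamma> \<nu> s"
  by (simp add: fun_eq_iff x_T_def horocyclic_involute_def)

text \<open>A connected set with two points has no isolated point; hence derivatives within
  \<open>I\<close> are unique, also at end points, and \<open>vector_derivative\<close> takes the
  computed value.\<close>

lemma nontrivial_interval_at_within_neq_bot:
  assumes "nontrivial_interval I" and "t \<in> I"
  shows "at t within I \<noteq> bot"
  using assms connected_imp_perfect[of I t]
  by (auto simp: nontrivial_interval_def is_interval_connected_1 trivial_limit_within)

theorem proposition4p7:
  fixes I :: "real set" and \<gamma> \<nu> :: "real \<Rightarrow> real^3" and m n s :: "real \<Rightarrow> real" and \<epsilon> :: real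
  assumes "spacelike_legendre_curve I \<gamma> \<nu>"
    and "legendre_curvature I \<gamma> \<nu> m n"
    and "I \<subseteq> closure {t \<in> I. n t \<noteq> 0}"
    and "\<epsilon> = 1 \<or> \<epsilon> = -1"
    and "smooth_on I s"
    and "\<forall>t\<in>I. (s has_real_derivative (m t + \<epsilon> * n t) / 2 * (s t)^2 - m t) (at t within I)"
  shows "legendre_family UNIV I (x_T \<epsilon> \<gamma> \<nu>) (nu_T \<epsilon> \<gamma> \<nu>) \<and>
         pre_enveloid (pi / 2) UNIV I (x_T \<epsilon> \<gamma> \<nu>) (nu_T \<epsilon> \<gamma> \<nu>) I (\<lambda>t. (s t, t)) \<and>
         (\<forall>t\<in>I. horocyclic_involute \<epsilon> \<gamma> \<nu> s t = (x_T \<epsilon> \<gamma> \<nu> \<circ> (\<lambda>t. (s t, t))) t) \<and>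
         enveloid (pi / 2) UNIV I (x_T \<epsilon> \<gamma> \<nu>) (nu_T \<epsilon> \<gamma> \<nu>) I (horocyclic_involute \<epsilon> \<gamma> \<nu> s)"
proof -
  have eps: "\<epsilon>\<^sup>2 = 1"
    using assms(4) by auto
  have I: "nontrivial_interval I" and D: "\<And>t. t \<in> I \<Longrightarrow> (\<gamma> t, \<nu> t) \<in> Delta1"
    using assms(1) by (auto simp: spacelike_legendre_curve_def)
  have family: "legendre_family UNIV I (x_T \<epsilon> \<gamma> \<nu>) (nu_T \<epsilon> \<gamma> \<nu>)"
    by (rule legendre_family_horocycles[OF assms(1) eps])
  \<comment> \<open>Here \<open>snd\<close> composed with the graph map is the identity, which
    separates the two points of \<open>K\<close>.\<close>
  have not_const: "\<not> (snd \<circ> (\<lambda>t. (s t, t))) constant_on K" if "nontrivial_interval K" for K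
    using that unfolding nontrivial_interval_def constant_on_def comp_def snd_conv
    by (metis less_irrefl)
  have "parallel (vector_derivative (horocyclic_involute \<epsilon> \<gamma> \<nu> s) (at t within I))
      (nu_T \<epsilon> \<gamma> \<nu> (s t, t))" if t: "t \<in> I" for t
  proof -
    have "vector_derivative (horocyclic_involute \<epsilon> \<gamma> \<nu> s) (at t within I) =
        ((m t + \<epsilon> * n t) * s t) *\<^sub>R nu_T \<epsilon> \<gamma> \<nu> (s t, t)"
      using has_vector_derivative_horocyclic_involute[OF assms(2) D[OF t] t eps] assms(6) t
      by (intro vector_derivative_within nontrivial_interval_at_within_neq_bot[OF I t]) blast
    then show ?thesis
      unfolding parallel_def
      \<comment> \<open>The coefficient 1 keeps the pair nonzero even where the derivative of the
        involute vanishes.\<close>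
      by (intro exI[of _ 1] exI[of _ "- ((m t + \<epsilon> * n t) * s t)"]) simp
  qed
  \<comment> \<open>At pi/2 the cosine is 0 and the sine 1, so the prescribed direction is
    \<open>nu_T\<close> itself.\<close>
  then have pre: "pre_enveloid (pi / 2) UNIV I (x_T \<epsilon> \<gamma> \<nu>) (nu_T \<epsilon> \<gamma> \<nu>) I (\<lambda>t. (s t, t))"
    using family I not_const
      smooth_on_Pair[OF assms(5) smooth_on_bounded_linear[OF bounded_linear_ident]]
    by (auto simp: pre_enveloid_def x_T_comp_graph)
  then show ?thesis
    using family unfolding enveloid_def by (metis x_T_comp_graph)
qed

end
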